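(* Let $\alpha,\beta\in\mathbb{K}^*$ be roots of unity with $\alpha\beta\neq1$, and let $\underline{\mu}=(\mu_1,\mu_2,\mu_3,\mu_4)\in(\mathbb{K}^* )^4$. Then the module $\mathscr{V}_1(\underline{\mu})$ is a simple $M_2(\alpha,\beta)$-module of dimension $l_1l_2$ over $\mathbb{K}$.
   Context: $\mathbb{K}$ is an algebraically closed field of arbitrary characteristic and $\mathbb{K}^*=\mathbb{K}\setminus\{0\}$; all modules are right modules. For a root of unity $\xi\in\mathbb{K}^*$, $\operatorname{ord}(\xi)$ is its order in the group $\mathbb{K}^*$. For $\alpha,\beta\in\mathbb{K}^*$, the two-parameter quantum matrix algebra $M_2(\alpha,\beta)$ is the associative unital $\mathbb{K}$-algebra generated by $X_{11},X_{12},X_{21},X_{22}$ subject to the relations $X_{12}X_{11}=\alpha X_{11}X_{12}$, $X_{22}X_{21}=\alpha X_{21}X_{22}$, $X_{21}X_{11}=\beta X_{11}X_{21}$, $X_{22}X_{12}=\beta X_{12}X_{22}$, $X_{21}X_{12}=\beta\alpha^{-1}X_{12}X_{21}$, $X_{22}X_{11}-X_{11}X_{22}=(\beta-\alpha^{-1})X_{12}X_{21}$. Set $l_1:=\operatorname{ord}(\alpha\beta)$ if $\operatorname{ord}(\beta)\mid\operatorname{ord}(\alpha\beta)\operatorname{ord}(\alpha\beta^{-1})$ and $l_1:=2\operatorname{ord}(\alpha\beta)$ otherwise; set $l_2:=\operatorname{ord}(\alpha\beta^{-1})$. $\mathscr{V}_1(\underline{\mu})$ is the $\mathbb{K}$-vector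 space with basis $\{e(a,b):0\le a\le l_1-1,\ 0\le b\le l_2-1\}$ and $M_2(\alpha,\beta)$-action (which does define a module structure) $$e(a,b)X_{11}=\mu_1\beta^b e(a\oplus1,b),$$ $$e(a,b)X_{12}=\begin{cases}\mu_2^{-1}\mu_3(\alpha^{-1}\beta)^b(\alpha\beta)^{-a}e(a,b-1)& b\neq0\\ \mu_2^{-1}\mu_3\beta^{al_2}(\alpha\beta)^{-a}e(a,l_2-1)& b=0\end{cases}$$ $$e(a,b)X_{21}=\begin{cases}\mu_2e(a,b+1)& b\neq l_2-1\\ \mu_2\beta^{-al_2}e(a,0)& b=l_2-1\end{cases}$$ $$e(a,b)X_{22}=\mu_1^{-1}\alpha^{-b}\left[\mu_4+\beta(\alpha\beta)^{-a}\mu_3\right]e(a\oplus(-1),b),$$ where $\oplus$ is addition modulo $l_1$. *)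

theory Defs
  imports
    "HOL-Algebra.Algebraic_Closure_Type"
    "HOL-Algebra.Multiplicative_Group"
    "HOL-Algebra.Module"
    "HOL-Algebra.QuotRing"
    "HOL-Library.Poly_Mapping"
begin

section \<open>Simple right modules over a not necessarily commutative ring\<close>

text \<open>
  The library's \<^locale>\<open>module\<close> is restricted to commutative rings. We reuse its record type
  and its \<^locale>\<open>submodule\<close>, which are not; for a right module,
  \<open>r \<odot>\<^bsub>M\<^esub> x\<close> stands for \<open>x\<close> acted upon by \<open>r\<close> from the right. The fields
  \<open>mult\<close> and \<open>one\<close> of the record are irrelevant.
\<close>

locale right_module = R?: ring R + M?: abelian_group M
  for R :: "('r, 'm) ring_scheme" (structure) and M :: "('r, 'v, 'n) module_scheme" (structure) +
  assumes smult_closed: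
      "\<lbrakk>r \<in> carrier R; x \<in> carrier M\<rbrakk> \<Longrightarrow> r \<odot>\<^bsub>M\<^esub> x \<in> carrier M"
    and smult_add_ring:
      "\<lbrakk>r \<in> carrier R; s \<in> carrier R; x \<in> carrier M\<rbrakk>
        \<Longrightarrow> (r \<oplus>\<^bsub>R\<^esub> s) \<odot>\<^bsub>M\<^esub> x = r \<odot>\<^bsub>M\<^esub> x \<oplus>\<^bsub>M\<^esub> s \<odot>\<^bsub>M\<^esub> x"
    and smult_add_module:
      "\<lbrakk>r \<in> carrier R; x \<in> carrier M; y \<in> carrier M\<rbrakk>
        \<Longrightarrow> r \<odot>\<^bsub>M\<^esub> (x \<oplus>\<^bsub>M\<^esub> y) = r \<odot>\<^bsub>M\<^esub> x \<oplus>\<^bsub>M\<^esub> r \<odot>\<^bsub>M\<^esub> y"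
    and smult_mult:
      "\<lbrakk>r \<in> carrier R; s \<in> carrier R; x \<in> carrier M\<rbrakk>
        \<Longrightarrow> (r \<otimes>\<^bsub>R\<^esub> s) \<odot>\<^bsub>M\<^esub> x = s \<odot>\<^bsub>M\<^esub> (r \<odot>\<^bsub>M\<^esub> x)"
    and smult_one:
      "x \<in> carrier M \<Longrightarrow> \<one>\<^bsub>R\<^esub> \<odot>\<^bsub>M\<^esub> x = x"

locale simple_right_module = right_module R M
  for R :: "('r, 'm) ring_scheme" (structure) and M :: "('r, 'v, 'n) module_scheme" (structure) +
  assumes nonzero: "carrier M \<noteq> {\<zero>\<^bsub>M\<^esub>}"
    and submodule_trivial: "submodule N R M \<Longrightarrow> N = {\<zero>\<^bsub>M\<^esub>} \<or> N = carrier M"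


section \<open>Vector spaces with a chosen basis\<close>

text \<open>Elements of the space with basis \<open>'b\<close> are finitely supported functions;
  the basis vector at \<open>x\<close> is \<^term>\<open>Poly_Mapping.single x 1\<close>.\<close>

definition scale :: "'k::field \<Rightarrow> ('b \<Rightarrow>\<^sub>0 'k) \<Rightarrow> ('b \<Rightarrow>\<^sub>0 'k)"
  where "scale c = Poly_Mapping.map ((*) c)"

definition lin_ext :: "('b \<Rightarrow> ('c \<Rightarrow>\<^sub>0 'k)) \<Rightarrow> ('b \<Rightarrow>\<^sub>0 'k::field) \<Rightarrow> ('c \<Rightarrow>\<^sub>0 'k)"
  where "lin_ext \<phi> f = (\<Sum>x\<in>Poly_Mapping.keys f. scale (Poly_Mapping.lookup f x) (\<phi> x))"

lemma lookup_scale: "Poly_Mapping.lookup (scale c f) x = c * Poly_Mapping.lookup f x"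
  by (simp add: scale_def Poly_Mapping.map.rep_eq when_def)

lemma vector_space_scale: "vector_space (scale :: 'k::field \<Rightarrow> ('b \<Rightarrow>\<^sub>0 'k) \<Rightarrow> _)"
  by unfold_locales
    (auto intro!: poly_mapping_eqI simp: lookup_scale lookup_add algebra_simps)


section \<open>The two-parameter quantum matrix algebra\<close>

datatype generator = X11 | X12 | X21 | X22

text \<open>The free monoid on the generators, written additively so that the library's
  convolution product on \<^typ>\<open>'a \<Rightarrow>\<^sub>0 'k\<close> is the product of the free algebra.\<close>

datatype word = Word (letters: "generator list")

instantiation word :: monoid_add
begin
definition zero_word :: word where "0 = Word []"
definition plus_word :: "word \<Rightarrow> word \<Rightarrow> word" where "v + w = Word (letters v @ letters w)"
instance by standard (simp_all add: zero_word_def plus_word_def)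
end

definition free_algebra :: "(word \<Rightarrow>\<^sub>0 'k::field) ring"
  where "free_algebra = ring_of_type_algebra"

definition var :: "generator \<Rightarrow> (word \<Rightarrow>\<^sub>0 'k::field)"
  where "var g = Poly_Mapping.single (Word [g]) 1"

definition const :: "'k::field \<Rightarrow> (word \<Rightarrow>\<^sub>0 'k)"
  where "const c = Poly_Mapping.single 0 c"

definition qm_relations :: "'k::field \<Rightarrow> 'k \<Rightarrow> (word \<Rightarrow>\<^sub>0 'k) set"
  where "qm_relations \<alpha> \<beta> =
   {var X12 * var X11 - const \<alpha> * var X11 * var X12,
    var X22 * var X21 - const \<alpha> * var X21 * var X22,
    var X21 * var X11 - const \<beta> * var X11 * var X21,
    var X22 * var X12 - const \<beta> * var X12 * var X22,
    var X21 * var X12 - const (\<beta> * inverse \<alpha>) * var X12 * var X21,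
    var X22 * var X11 - var X11 * var X22 - const (\<beta> - inverse \<alpha>) * var X12 * var X21}"

definition qm_ideal :: "'k::field \<Rightarrow> 'k \<Rightarrow> (word \<Rightarrow>\<^sub>0 'k) set"
  where "qm_ideal \<alpha> \<beta> = Idl\<^bsub>free_algebra\<^esub> (qm_relations \<alpha> \<beta>)"

definition M2 :: "'k::field \<Rightarrow> 'k \<Rightarrow> (word \<Rightarrow>\<^sub>0 'k) set ring"
  where "M2 \<alpha> \<beta> = free_algebra Quot (qm_ideal \<alpha> \<beta>)"


section \<open>The module\<close>

definition ord :: "'k::field \<Rightarrow> nat"
  where "ord \<xi> = group.ord (Multiplicative_Group.mult_of (ring_of_type_algebra :: 'k ring)) \<xi>"

definition root_of_unity :: "'k::field \<Rightarrow> bool"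
  where "root_of_unity \<xi> \<longleftrightarrow> (\<exists>n>0. \<xi> ^ n = 1)"

definition l1 :: "'k::field \<Rightarrow> 'k \<Rightarrow> nat"
  where "l1 \<alpha> \<beta> =
    (if ord \<beta> dvd ord (\<alpha> * \<beta>) * ord (\<alpha> * inverse \<beta>) then ord (\<alpha> * \<beta>) else 2 * ord (\<alpha> * \<beta>))"

definition l2 :: "'k::field \<Rightarrow> 'k \<Rightarrow> nat"
  where "l2 \<alpha> \<beta> = ord (\<alpha> * inverse \<beta>)"

definition plus_mod :: "nat \<Rightarrow> nat \<Rightarrow> int \<Rightarrow> nat"
  where "plus_mod l a k = nat ((int a + k) mod int l)"

definition e :: "nat \<Rightarrow> nat \<Rightarrow> (nat \<times> nat \<Rightarrow>\<^sub>0 'k::field)"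
  where "e a b = Poly_Mapping.single (a, b) 1"

text \<open>The image of \<^term>\<open>e a b\<close> under a generator.\<close>

fun V1_generator :: "'k::field \<Rightarrow> 'k \<Rightarrow> 'k \<Rightarrow> 'k \<Rightarrow> 'k \<Rightarrow> 'k
    \<Rightarrow> generator \<Rightarrow> nat \<times> nat \<Rightarrow> (nat \<times> nat \<Rightarrow>\<^sub>0 'k)"
  where
  "V1_generator \<alpha> \<beta> \<mu>1 \<mu>2 \<mu>3 \<mu>4 X11 (a, b) =
     scale (\<mu>1 * \<beta> ^ b) (e (plus_mod (l1 \<alpha> \<beta>) a 1) b)"
| "V1_generator \<alpha> \<beta> \<mu>1 \<mu>2 \<mu>3 \<mu>4 X12 (a, b) =
     (if b \<noteq> 0
      then scale (inverse \<mu>2 * \<mu>3 * (inverse \<alpha> * \<beta>) ^ b * (\<alpha> * \<beta>) powi (- int a)) (e a (b - 1))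
      else scale (inverse \<mu>2 * \<mu>3 * \<beta> ^ (a * l2 \<alpha> \<beta>) * (\<alpha> * \<beta>) powi (- int a))
             (e a (l2 \<alpha> \<beta> - 1)))"
| "V1_generator \<alpha> \<beta> \<mu>1 \<mu>2 \<mu>3 \<mu>4 X21 (a, b) =
     (if b \<noteq> l2 \<alpha> \<beta> - 1
      then scale \<mu>2 (e a (b + 1))
      else scale (\<mu>2 * \<beta> powi (- int (a * l2 \<alpha> \<beta>))) (e a 0))"
| "V1_generator \<alpha> \<beta> \<mu>1 \<mu>2 \<mu>3 \<mu>4 X22 (a, b) =
     scale (inverse \<mu>1 * \<alpha> powi (- int b) * (\<mu>4 + \<beta> * (\<alpha> * \<beta>) powi (- int a) * \<mu>3))
       (e (plus_mod (l1 \<alpha> \<beta>) a (-1)) b)"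

text \<open>Under a right action, the first letter of a word acts first.\<close>

definition V1_free_action :: "'k::field \<Rightarrow> 'k \<Rightarrow> 'k \<Rightarrow> 'k \<Rightarrow> 'k \<Rightarrow> 'k
    \<Rightarrow> (word \<Rightarrow>\<^sub>0 'k) \<Rightarrow> (nat \<times> nat \<Rightarrow>\<^sub>0 'k) \<Rightarrow> (nat \<times> nat \<Rightarrow>\<^sub>0 'k)"
  where "V1_free_action \<alpha> \<beta> \<mu>1 \<mu>2 \<mu>3 \<mu>4 p v =
    lin_ext (\<lambda>w. fold (\<lambda>g. lin_ext (V1_generator \<alpha> \<beta> \<mu>1 \<mu>2 \<mu>3 \<mu>4 g)) (letters w) v) p"

text \<open>An element of \<^term>\<open>M2 \<alpha> \<beta>\<close> is a coset, and it acts as any of its representatives; that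
  this is independent of the representative is shown below (\<open>V1_smult\<close>), as is the fact
  that the generators act by \<^const>\<open>V1_generator\<close> and the scalars by \<^const>\<open>scale\<close>.\<close>

definition V1 :: "'k::field \<Rightarrow> 'k \<Rightarrow> 'k \<Rightarrow> 'k \<Rightarrow> 'k \<Rightarrow> 'k
    \<Rightarrow> ((word \<Rightarrow>\<^sub>0 'k) set, nat \<times> nat \<Rightarrow>\<^sub>0 'k) module"
  where "V1 \<alpha> \<beta> \<mu>1 \<mu>2 \<mu>3 \<mu>4 =
   \<lparr>carrier = {v. Poly_Mapping.keys v \<subseteq> {0..<l1 \<alpha> \<beta>} \<times> {0..<l2 \<alpha> \<beta>}},
    monoid.mult = undefined, one = undefined,
    ring.zero = 0, add = (+),
    module.smult = (\<lambda>r v. the_elem ((\<lambda>p. V1_free_action \<alpha> \<beta> \<mu>1 \<mu>2 \<mu>3 \<mu>4 p v) ` r))\<rparr>"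


section \<open>The action is well defined\<close>



lemma scale_simps [simp]: "scale 0 f = 0" "scale 1 f = f" "scale c 0 = 0"
  "scale c (scale d f) = scale (c * d) f"
  by (auto intro!: poly_mapping_eqI simp: lookup_scale)
lemma scale_add: "scale c (f + g) = scale c f + scale c g"
  by (auto intro!: poly_mapping_eqI simp: lookup_scale lookup_add algebra_simps)
lemma scale_add_left: "scale (c + d) f = scale c f + scale d f"
  by (auto intro!: poly_mapping_eqI simp: lookup_scale lookup_add algebra_simps)
lemma scale_minus: "scale (c - d) f = scale c f - scale d f"
  by (auto intro!: poly_mapping_eqI simp: lookup_scale lookup_minus left_diff_distrib)
lemma scale_sum: "scale c (sum f A) = (\<Sum>x\<in>A. scale c (f x))"
  by (induction A rule: infinite_finite_induct) (auto simp: scale_add)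

lemma lin_ext_sub: "finite A \<Longrightarrow> Poly_Mapping.keys f \<subseteq> A \<Longrightarrow>
   lin_ext \<phi> f = (\<Sum>x\<in>A. scale (Poly_Mapping.lookup f x) (\<phi> x))"
  unfolding lin_ext_def by (rule sum.mono_neutral_left) (auto simp: in_keys_iff)

lemma lin_ext_add: "lin_ext \<phi> (f + g) = lin_ext \<phi> f + lin_ext \<phi> g"
proof -
  let ?A = "Poly_Mapping.keys f \<union> Poly_Mapping.keys g"
  have "Poly_Mapping.keys (f + g) \<subseteq> ?A" by (rule keys_add)
  then show ?thesis
    by (simp add: lin_ext_sub[of ?A] lookup_add scale_add_left sum.distrib)
qed

lemma lin_ext_scale: "lin_ext \<phi> (scale c f) = scale c (lin_ext \<phi> f)"
proof -
  have "Poly_Mapping.keys (scale c f) \<subseteq> Poly_Mapping.keys f"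
    by (auto simp: in_keys_iff lookup_scale)
  then show ?thesis
    by (simp add: lin_ext_sub[of "Poly_Mapping.keys f"] lookup_scale scale_sum)
qed

lemma lin_ext_zero [simp]: "lin_ext \<phi> 0 = 0" by (simp add: lin_ext_def)
lemma lin_ext_single [simp]: "lin_ext \<phi> (Poly_Mapping.single x c) = scale c (\<phi> x)"
  by (simp add: lin_ext_def)
lemma lin_ext_minus: "lin_ext \<phi> (f - g) = lin_ext \<phi> f - lin_ext \<phi> g"
  by (metis (no_types) lin_ext_add add_diff_cancel diff_add_cancel)

lemma pm_decomp: "f = (\<Sum>x\<in>Poly_Mapping.keys f. Poly_Mapping.single x (Poly_Mapping.lookup f x))"
  by (rule poly_mapping_eqI) (auto simp: lookup_sum lookup_single when_def in_keys_iff)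

lemma pm_induct [case_names zero add]:
  assumes "P 0" "\<And>f x c. P f \<Longrightarrow> x \<notin> Poly_Mapping.keys f \<Longrightarrow> P (Poly_Mapping.single x c + f)"
  shows "P f"
proof (induction f rule: update_induct)
  case const then show ?case by (rule assms)
next
  case (update f a b)
  have "Poly_Mapping.update a b f = Poly_Mapping.single a b + f"
    using update(1) by (intro poly_mapping_eqI)
     (auto simp: lookup_update lookup_add lookup_single in_keys_iff)
  then show ?case using assms(2)[OF update(3,1)] by simp
qed

locale V1_setup =
  fixes \<alpha> \<beta> \<mu>1 \<mu>2 \<mu>3 \<mu>4 :: "'k::field"
  assumes nz: "\<alpha> \<noteq> 0" "\<beta> \<noteq> 0" "\<mu>1 \<noteq> 0" "\<mu>2 \<noteq> 0"
    and ru: "root_of_unity \<alpha>" "root_of_unity \<beta>"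
begin

abbreviation "G \<equiv> \<lambda>g. lin_ext (V1_generator \<alpha> \<beta> \<mu>1 \<mu>2 \<mu>3 \<mu>4 g)"
abbreviation "act \<equiv> V1_free_action \<alpha> \<beta> \<mu>1 \<mu>2 \<mu>3 \<mu>4"
abbreviation "V \<equiv> V1 \<alpha> \<beta> \<mu>1 \<mu>2 \<mu>3 \<mu>4"
abbreviation "L1 \<equiv> l1 \<alpha> \<beta>"
abbreviation "L2 \<equiv> l2 \<alpha> \<beta>"

lemma W_add: "fold G ws (u + v) = fold G ws u + fold G ws v"
  by (induction ws arbitrary: u v) (auto simp: lin_ext_add)
lemma W_scale: "fold G ws (scale c u) = scale c (fold G ws u)"
  by (induction ws arbitrary: u) (auto simp: lin_ext_scale)
lemma W_zero [simp]: "fold G ws 0 = 0"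
  by (induction ws) auto

lemma act_add: "act (p + q) v = act p v + act q v"
  by (simp add: V1_free_action_def lin_ext_add)
lemma act_minus: "act (p - q) v = act p v - act q v"
  by (simp add: V1_free_action_def lin_ext_minus)
lemma act_single: "act (Poly_Mapping.single w c) v = scale c (fold G (letters w) v)"
  by (simp add: V1_free_action_def)
lemma act_0 [simp]: "act 0 v = 0" by (simp add: V1_free_action_def)
lemma act_v0 [simp]: "act p 0 = 0" by (simp add: V1_free_action_def lin_ext_def)
lemma act_addv: "act p (u + v) = act p u + act p v"
  by (simp add: V1_free_action_def lin_ext_def W_add scale_add sum.distrib)
lemma act_scalev: "act p (scale c u) = scale c (act p u)"
  by (simp add: V1_free_action_def lin_ext_def W_scale scale_sum mult.commute)
lemma act_mult1: "act (Poly_Mapping.single w c * Poly_Mapping.single w' d) v = act (Poly_Mapping.single w' d) (act (Poly_Mapping.single w c) v)"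
  by (simp add: mult_single act_single plus_word_def W_scale mult.commute)
lemma act_mult: "act (p * q) v = act q (act p v)"
proof (induction p rule: pm_induct)
  case (add f x c)
  have "act (Poly_Mapping.single x c * q) v = act q (act (Poly_Mapping.single x c) v)"
    by (induction q rule: pm_induct) (auto simp: act_add act_mult1 distrib_left)
  with add show ?case by (simp add: distrib_right act_add act_addv)
qed auto
lemma act_var: "act (var g) v = G g v" by (simp add: var_def act_single)
lemma act_const: "act (const c) v = scale c v"
  by (simp add: const_def act_single zero_word_def)
end

lemma pow_T: "x [^]\<^bsub>Multiplicative_Group.mult_of (ring_of_type_algebra :: 'k::field ring)\<^esub> (n::nat) = x ^ n"
proof -
  have "x [^]\<^bsub>(ring_of_type_algebra :: 'k::field ring)\<^esub> (n::nat) = x ^ n"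
    by (induction n) (simp_all add: nat_pow_def ring_of_type_algebra_def mult.commute)
  then show ?thesis by (simp add: Multiplicative_Group.nat_pow_mult_of)
qed

lemma ord_iff: "(x::'k::field) \<noteq> 0 \<Longrightarrow> x ^ n = 1 \<longleftrightarrow> ord x dvd n"
proof -
  assume "x \<noteq> 0"
  interpret F: field "ring_of_type_algebra :: 'k ring" by (rule field_from_type_algebra)
  show ?thesis using group.pow_eq_id[OF F.field_mult_group, of x n] \<open>x \<noteq> 0\<close>
    by (simp add: pow_T ord_def) (simp add: ring_of_type_algebra_def)
qed

lemma ord_pos: "(x::'k::field) \<noteq> 0 \<Longrightarrow> root_of_unity x \<Longrightarrow> ord x > 0"
  unfolding root_of_unity_def by (auto simp: ord_iff dest: dvd_pos_nat)

lemma ru_mult: "root_of_unity x \<Longrightarrow> root_of_unity y \<Longrightarrow> root_of_unity (x * y)"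
proof -
  assume "root_of_unity x" "root_of_unity y"
  then obtain m n where "m > 0" "x ^ m = 1" "n > 0" "y ^ n = 1" unfolding root_of_unity_def by auto
  then have "(x * y) ^ (m * n) = 1"
    by (metis mult.commute mult.right_neutral power_mult power_mult_distrib power_one)
  with \<open>m>0\<close> \<open>n>0\<close> show ?thesis unfolding root_of_unity_def by (intro exI[of _ "m * n"]) auto
qed
lemma ru_inv: "root_of_unity x \<Longrightarrow> root_of_unity (inverse x)"
  unfolding root_of_unity_def by (auto simp: power_inverse)

context V1_setup begin

lemma nzi: "\<alpha> * \<beta> \<noteq> 0" "\<alpha> * inverse \<beta> \<noteq> 0" using nz by auto
lemma L2_pos: "L2 > 0" unfolding l2_def using nzi ru by (intro ord_pos ru_mult ru_inv)
lemma ab_pos: "ord (\<alpha> * \<beta>) > 0" using nzi ru by (intro ord_pos ru_mult ru_inv)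
lemma L1_pos: "L1 > 0" using ab_pos by (auto simp: l1_def)
lemma ab_L1: "(\<alpha> * \<beta>) ^ L1 = 1" using nzi by (auto simp: l1_def ord_iff)
lemma q_L2: "\<alpha> ^ L2 = \<beta> ^ L2"
proof -
  have "(\<alpha> * inverse \<beta>) ^ L2 = 1" using nzi by (simp add: l2_def ord_iff)
  then show ?thesis using nz by (simp add: power_mult_distrib power_inverse field_simps)
qed
lemma b_L: "\<beta> ^ (L1 * L2) = 1"
proof (cases "ord \<beta> dvd ord (\<alpha> * \<beta>) * ord (\<alpha> * inverse \<beta>)")
  case True then show ?thesis using nz by (simp add: ord_iff l1_def l2_def)
next
  case False
  let ?o = "ord (\<alpha> * \<beta>)"
  have 1: "(\<alpha> * \<beta>) ^ (?o * L2) = 1" using nzi by (simp add: ord_iff)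
  have 2: "\<alpha> ^ (?o * L2) = \<beta> ^ (?o * L2)" using q_L2 by (metis mult.commute power_mult)
  have "\<beta> ^ (?o * L2) * \<beta> ^ (?o * L2) = 1" using 1 2 by (simp add: power_mult_distrib)
  then show ?thesis using False by (simp add: l1_def mult_2 power_add distrib_right)
qed

definition "indices = {0..<L1} \<times> {0..<L2}"
lemma carrier_V: "carrier V = {v. Poly_Mapping.keys v \<subseteq> indices}" by (simp add: V1_def indices_def)

lemma V_zero: "0 \<in> carrier V" by (simp add: carrier_V)
lemma V_add: "u \<in> carrier V \<Longrightarrow> v \<in> carrier V \<Longrightarrow> u + v \<in> carrier V"
  using keys_add by (fastforce simp: carrier_V)
lemma V_scale: "u \<in> carrier V \<Longrightarrow> scale c u \<in> carrier V"
  by (auto simp: carrier_V in_keys_iff lookup_scale)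
lemma V_sum: "(\<And>x. x \<in> A \<Longrightarrow> f x \<in> carrier V) \<Longrightarrow> sum f A \<in> carrier V"
  by (induction A rule: infinite_finite_induct) (auto simp: V_zero V_add)
lemma V_e: "a < L1 \<Longrightarrow> b < L2 \<Longrightarrow> e a b \<in> carrier V"
  by (auto simp: carrier_V e_def indices_def)

lemma pm_lt: "plus_mod L1 a k < L1"
  using L1_pos by (simp add: plus_mod_def nat_less_iff)

lemma gen_carrier: "x \<in> indices \<Longrightarrow> V1_generator \<alpha> \<beta> \<mu>1 \<mu>2 \<mu>3 \<mu>4 g x \<in> carrier V"
  using L2_pos
  by (cases x; cases g) (auto simp: indices_def intro!: V_scale V_e pm_lt)
lemma G_carrier: "v \<in> carrier V \<Longrightarrow> G g v \<in> carrier V"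
  unfolding lin_ext_def by (intro V_sum V_scale gen_carrier) (auto simp: carrier_V)
lemma W_carrier: "v \<in> carrier V \<Longrightarrow> fold G ws v \<in> carrier V"
  by (induction ws arbitrary: v) (auto intro: G_carrier)
lemma act_carrier: "v \<in> carrier V \<Longrightarrow> act p v \<in> carrier V"
  unfolding V1_free_action_def
  by (subst lin_ext_def) (intro V_sum V_scale W_carrier)

lemma pm1: "a < L1 \<Longrightarrow> plus_mod L1 a 1 = (if a = L1 - 1 then 0 else a + 1)"
  using L1_pos by (auto simp: plus_mod_def nat_mod_as_int of_nat_diff)
lemma pm2: "a < L1 \<Longrightarrow> plus_mod L1 a (-1) = (if a = 0 then L1 - 1 else a - 1)"
  using L1_pos by (auto simp: plus_mod_def zmod_minus1 of_nat_diff nat_diff_distrib)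

lemma G_e: "G g (e a b) = V1_generator \<alpha> \<beta> \<mu>1 \<mu>2 \<mu>3 \<mu>4 g (a, b)"
  by (simp add: e_def)


lemma pown: "(x::'k) powi (- int a) = inverse (x ^ a)"
  by (simp add: power_int_minus)

lemmas G_simps = G_e lin_ext_scale lin_ext_minus pm1 pm2 pown

lemma scale_e_eq: "c = d \<Longrightarrow> scale c (e a b) = scale d (e a b)" by simp

lemma ab_last: "(\<alpha> * \<beta>) ^ (L1 - Suc 0) = inverse (\<alpha> * \<beta>)"
  using ab_L1 L1_pos nz by (cases L1) (auto simp: field_simps)
lemma b_last: "\<beta> ^ ((L1 - Suc 0) * L2) = inverse (\<beta> ^ L2)"
  using b_L L1_pos nz by (cases L1) (auto simp: field_simps power_add)
lemma a_last: "\<alpha> ^ (L2 - Suc 0) = \<beta> ^ L2 * inverse \<alpha>"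
  using q_L2 L2_pos nz by (cases L2) (auto simp: field_simps)
lemma bl_last: "\<beta> ^ (L2 - Suc 0) = \<beta> ^ L2 * inverse \<beta>"
  using L2_pos nz by (cases L2) (auto simp: field_simps)

context fixes a b assumes ab: "a < L1" "b < L2" begin

lemma relation1: "G X11 (G X12 (e a b)) = scale \<alpha> (G X12 (G X11 (e a b)))"
proof -
  have s: "L1 > 0" "L2 > 0" by (rule L1_pos L2_pos)+
  have p: "b > 0 \<Longrightarrow> \<beta> ^ b = \<beta> * \<beta> ^ (b - 1)" by (cases b) auto
  show ?thesis using ab s nz
    by (auto simp: G_simps p bl_last ab_last b_last power_mult_distrib power_inverse
         power_add intro!: scale_e_eq) (auto simp: field_simps ab_last b_last ab_last[unfolded power_mult_distrib])
qed
lemma relation2: "G X21 (G X22 (e a b)) = scale \<alpha> (G X22 (G X21 (e a b)))"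
proof -
  have s: "L1 > 0" "L2 > 0" by (rule L1_pos L2_pos)+
  have p: "a > 0 \<Longrightarrow> \<beta> ^ (a * L2) = \<beta> ^ L2 * \<beta> ^ ((a - 1) * L2)" by (cases a) (auto simp: power_add)
  show ?thesis using ab s nz
    by (auto simp: G_simps p a_last b_last power_mult_distrib power_inverse
 power_add simp del: of_nat_mult of_nat_Suc of_nat_add of_nat_diff intro!: scale_e_eq)
qed
lemma relation3: "G X11 (G X21 (e a b)) = scale \<beta> (G X21 (G X11 (e a b)))"
proof -
  have s: "L1 > 0" "L2 > 0" by (rule L1_pos L2_pos)+
  show ?thesis using ab s nz
    by (auto simp: G_simps bl_last b_last power_mult_distrib power_inverse
 power_add simp del: of_nat_mult of_nat_Suc of_nat_add of_nat_diff intro!: scale_e_eq) (auto simp: field_simps)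
qed
lemma relation4: "G X12 (G X22 (e a b)) = scale \<beta> (G X22 (G X12 (e a b)))"
proof -
  have s: "L1 > 0" "L2 > 0" by (rule L1_pos L2_pos)+
  have p: "a > 0 \<Longrightarrow> (\<alpha> * \<beta>) ^ a = \<alpha> * \<beta> * (\<alpha> * \<beta>) ^ (a - 1)" by (cases a) auto
  have p2: "a > 0 \<Longrightarrow> \<beta> ^ (a * L2) = \<beta> ^ L2 * \<beta> ^ ((a - 1) * L2)" by (cases a) (auto simp: power_add)
  have p3: "b > 0 \<Longrightarrow> \<alpha> ^ b = \<alpha> * \<alpha> ^ (b - 1)" by (cases b) auto
  show ?thesis using ab s nz
    by (auto simp: G_simps p p2 p3 a_last b_last ab_last simp del: of_nat_mult of_nat_Suc of_nat_add of_nat_diff intro!: scale_e_eq)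
       (auto simp: field_simps a_last b_last p2 p3)
qed
lemma q_L2': "b = L2 - 1 \<Longrightarrow> inverse \<alpha> * \<beta> * (inverse \<alpha> * \<beta>) ^ b = 1"
  using q_L2 L2_pos nz
  by (cases L2) (auto simp: power_mult_distrib power_inverse field_simps)

lemma X12_X21: "G X21 (G X12 (e a b)) =
    scale (\<mu>3 * (inverse \<alpha> * \<beta>) ^ b * inverse ((\<alpha> * \<beta>) ^ a)) (e a b)"
proof (cases "b = 0")
  case True
  with ab nz show ?thesis
    by (simp add: G_simps del: of_nat_mult of_nat_Suc of_nat_add of_nat_diff) (rule scale_e_eq, simp add: field_simps)
next
  case False
  then have "b - 1 \<noteq> L2 - 1" "b - 1 + 1 = b" using ab by linarith+
  with False nz show ?thesis by (simp add: G_simps del: of_nat_mult of_nat_Suc of_nat_add of_nat_diff) (rule scale_e_eq, simp add: field_simps)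
qed

lemma X21_X12: "G X12 (G X21 (e a b)) =
    scale (\<mu>3 * (inverse \<alpha> * \<beta>) ^ Suc b * inverse ((\<alpha> * \<beta>) ^ a)) (e a b)"
proof (cases "b = L2 - 1")
  case True
  with q_L2'[OF True] nz show ?thesis
    by (simp add: G_simps del: of_nat_mult of_nat_Suc of_nat_add of_nat_diff) (rule scale_e_eq, simp add: field_simps)
next
  case False
  with nz show ?thesis by (simp add: G_simps del: of_nat_mult of_nat_Suc of_nat_add of_nat_diff) (rule scale_e_eq, simp add: field_simps)
qed

lemma X11_X22: "G X22 (G X11 (e a b)) =
    scale ((inverse \<alpha> * \<beta>) ^ b * (\<mu>4 + inverse \<alpha> * inverse ((\<alpha> * \<beta>) ^ a) * \<mu>3)) (e a b)"
proof (cases "a = L1 - 1")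
  case True
  then have "inverse ((\<alpha> * \<beta>) ^ a) = \<alpha> * \<beta>" using ab_last by simp
  with True nz L1_pos show ?thesis
    by (simp add: G_simps power_mult_distrib[of "inverse _"] power_inverse del: of_nat_mult of_nat_Suc of_nat_add of_nat_diff) (rule scale_e_eq, simp add: field_simps)
next
  case False
  then have "a + 1 < L1" using ab by linarith
  with False ab nz show ?thesis
    by (simp add: G_simps power_mult_distrib[of "inverse _"] power_inverse del: of_nat_mult of_nat_Suc of_nat_add of_nat_diff) (rule scale_e_eq, simp add: field_simps)
qed

lemma X22_X11: "G X11 (G X22 (e a b)) =
    scale ((inverse \<alpha> * \<beta>) ^ b * (\<mu>4 + \<beta> * inverse ((\<alpha> * \<beta>) ^ a) * \<mu>3)) (e a b)"
proof (cases "a = 0")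
  case True
  with ab nz L1_pos show ?thesis
    by (simp add: G_simps power_mult_distrib[of "inverse _"] power_inverse del: of_nat_mult of_nat_Suc of_nat_add of_nat_diff) (rule scale_e_eq, simp add: field_simps)
next
  case False
  then have "a - 1 \<noteq> L1 - 1" "a - 1 < L1" "a - 1 + 1 = a" using ab by linarith+
  with False ab nz show ?thesis
    by (simp add: G_simps power_mult_distrib[of "inverse _"] power_inverse del: of_nat_mult of_nat_Suc of_nat_add of_nat_diff) (rule scale_e_eq, simp add: field_simps)
qed

lemma relation5: "G X12 (G X21 (e a b)) = scale (\<beta> * inverse \<alpha>) (G X21 (G X12 (e a b)))"
  by (simp add: X12_X21 X21_X12 mult_ac)

lemma relation6: "G X11 (G X22 (e a b)) - G X22 (G X11 (e a b)) =
    scale (\<beta> - inverse \<alpha>) (G X21 (G X12 (e a b)))"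
  by (simp add: X12_X21 X22_X11 X11_X22 scale_minus[symmetric] algebra_simps)

end

definition "annihilator = {p. \<forall>v \<in> carrier V. act p v = 0}"

lemma kill_basis:
  assumes "\<And>a b. a < L1 \<Longrightarrow> b < L2 \<Longrightarrow> act p (e a b) = 0" shows "p \<in> annihilator"
proof -
  have "act p v = 0" if "v \<in> carrier V" for v
  proof -
    have s: "act p (sum f A) = (\<Sum>x\<in>A. act p (f x))" for f and A :: "(nat \<times> nat) set"
      by (induction A rule: infinite_finite_induct) (auto simp: act_addv)
    have "Poly_Mapping.single x c = scale c (e (fst x) (snd x))" for x and c :: 'k
      by (auto intro!: poly_mapping_eqI simp: e_def lookup_scale lookup_single when_def)
    then have sg: "scale c (e (fst x) (snd x)) = Poly_Mapping.single x c" for x and c :: 'k by simp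
    have "act p v = (\<Sum>x\<in>Poly_Mapping.keys v. scale (Poly_Mapping.lookup v x) (act p (e (fst x) (snd x))))"
      by (subst pm_decomp[of v], subst s) (simp add: act_scalev[symmetric] sg)
    also have "\<dots> = 0"
      using that by (intro sum.neutral) (auto simp: carrier_V indices_def assms subset_iff)
    finally show ?thesis .
  qed
  then show ?thesis by (simp add: annihilator_def)
qed

lemma rel_kill: "qm_relations \<alpha> \<beta> \<subseteq> annihilator"
  unfolding qm_relations_def
  by (auto intro!: kill_basis simp: act_minus act_mult act_var act_const lin_ext_scale relation1 relation2 relation3 relation4 relation5 relation6)

end

lemma ring_free: "ring (free_algebra :: (word \<Rightarrow>\<^sub>0 'k::field) ring)"
proof -
  have "\<exists>y. x + y = 0" for x :: "word \<Rightarrow>\<^sub>0 'k" using add.right_inverse by blast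
  then show ?thesis unfolding free_algebra_def ring_of_type_algebra_def using add.right_inverse
    by unfold_locales (auto simp:algebra_simps Units_def)
qed

lemma free_simps [simp]: "carrier free_algebra = UNIV" "add free_algebra = (+)" "monoid.mult free_algebra = (*)"
  "one free_algebra = 1" "ring.zero free_algebra = 0"
  by (auto simp: free_algebra_def ring_of_type_algebra_def)

lemma ideal_qm: "ideal (qm_ideal \<alpha> \<beta>) free_algebra"
  unfolding qm_ideal_def by (rule ring.genideal_ideal[OF ring_free]) simp

context V1_setup begin

lemma ideal_annihilator: "ideal annihilator free_algebra"
proof (rule idealI[OF ring_free])
  interpret R: ring "free_algebra :: (word \<Rightarrow>\<^sub>0 'k) ring" by (rule ring_free)
  have mi: "\<ominus>\<^bsub>free_algebra\<^esub> x = - x" for x :: "word \<Rightarrow>\<^sub>0 'k"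
    by (rule R.minus_equality) auto
  have am: "act (- p) v = - act p v" for p v using act_minus[of 0 p v] by simp
  show "subgroup annihilator (add_monoid free_algebra)"
    by (rule group.subgroupI[OF abelian_group.a_group])
     (auto simp: R.abelian_group_axioms annihilator_def act_add am intro!: exI[of _ 0] simp: mi[unfolded a_inv_def, simplified])
qed (auto simp: annihilator_def act_mult act_carrier)

lemma ideal_sub: "qm_ideal \<alpha> \<beta> \<subseteq> annihilator"
  unfolding qm_ideal_def by (rule ring.genideal_minimal[OF ring_free ideal_annihilator rel_kill])

lemma V1_smult: "v \<in> carrier V \<Longrightarrow> (qm_ideal \<alpha> \<beta> +>\<^bsub>free_algebra\<^esub> p) \<odot>\<^bsub>V\<^esub> v = act p v"
proof -
  assume v: "v \<in> carrier V"
  have "(\<lambda>p. act p v) ` (qm_ideal \<alpha> \<beta> +>\<^bsub>free_algebra\<^esub> p) = {act p v}"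
  proof -
    have z: "act i v = 0" if "i \<in> qm_ideal \<alpha> \<beta>" for i using that ideal_sub v by (auto simp: annihilator_def)
    have "0 \<in> qm_ideal \<alpha> \<beta>"
      using additive_subgroup.zero_closed[OF ideal.axioms(1)[OF ideal_qm]] by (metis free_simps(5))
    then have "p \<in> qm_ideal \<alpha> \<beta> +>\<^bsub>free_algebra\<^esub> p" by (force simp: a_r_coset_def')
    then show ?thesis using z by (auto simp: a_r_coset_def' act_add)
  qed
  then show ?thesis by (simp add: V1_def)
qed

lemma V1_smult_generator: "a < L1 \<Longrightarrow> b < L2 \<Longrightarrow> (qm_ideal \<alpha> \<beta> +>\<^bsub>free_algebra\<^esub> var g) \<odot>\<^bsub>V\<^esub> (e a b)
   = V1_generator \<alpha> \<beta> \<mu>1 \<mu>2 \<mu>3 \<mu>4 g (a, b)"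
  by (simp add: V1_smult V_e act_var G_e)
lemma V1_smult_const: "v \<in> carrier V \<Longrightarrow> (qm_ideal \<alpha> \<beta> +>\<^bsub>free_algebra\<^esub> const c) \<odot>\<^bsub>V\<^esub> v = scale c v"
  by (simp add: V1_smult act_const)

lemma M2_el: "r \<in> carrier (M2 \<alpha> \<beta>) \<Longrightarrow> \<exists>p. r = qm_ideal \<alpha> \<beta> +>\<^bsub>free_algebra\<^esub> p"
  by (auto simp: M2_def FactRing_def A_RCOSETS_def RCOSETS_def a_r_coset_def)

lemma right_module_V1: "right_module (M2 \<alpha> \<beta>) V"
proof -
  interpret I: ideal "qm_ideal \<alpha> \<beta>" free_algebra by (rule ideal_qm)
  interpret R: ring "M2 \<alpha> \<beta>" unfolding M2_def by (rule I.quotient_is_ring)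
  have sadd [simp]: "add V = (+)" "ring.zero V = 0" by (auto simp: V1_def)
  have ag: "abelian_group V"
  proof (rule abelian_groupI)
    fix x assume "x \<in> carrier V"
    then show "\<exists>y\<in>carrier V. y \<oplus>\<^bsub>V\<^esub> x = \<zero>\<^bsub>V\<^esub>"
      by (intro bexI[of _ "- x"]) (auto simp: carrier_V)
  qed (auto simp: V_add V_zero ac_simps)
  have h: "(qm_ideal \<alpha> \<beta> +>\<^bsub>free_algebra\<^esub> p) \<oplus>\<^bsub>M2 \<alpha> \<beta>\<^esub> (qm_ideal \<alpha> \<beta> +>\<^bsub>free_algebra\<^esub> q) = qm_ideal \<alpha> \<beta> +>\<^bsub>free_algebra\<^esub> (p + q)"
   "(qm_ideal \<alpha> \<beta> +>\<^bsub>free_algebra\<^esub> p) \<otimes>\<^bsub>M2 \<alpha> \<beta>\<^esub> (qm_ideal \<alpha> \<beta> +>\<^bsub>free_algebra\<^esub> q) = qm_ideal \<alpha> \<beta> +>\<^bsub>free_algebra\<^esub> (p * q)"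
   "\<one>\<^bsub>M2 \<alpha> \<beta>\<^esub> = qm_ideal \<alpha> \<beta> +>\<^bsub>free_algebra\<^esub> const 1" for p q
    using I.a_rcos_sum[of p q] I.rcoset_mult_add[of p q] by (simp_all add: M2_def FactRing_def const_def)
  have "right_module_axioms (M2 \<alpha> \<beta>) V"
    by (rule right_module_axioms.intro)
     (auto dest!: M2_el simp: h V1_smult act_carrier act_add act_addv act_mult act_const V_add)
  with ag R.ring_axioms show ?thesis by (simp add: right_module_def)
qed
end

end

(* The elements X12 X21, X22 X11 and X21^l2 act diagonally on the basis e(a,b), and their joint
   eigenvalues determine q^b (where q = beta / alpha), (alpha beta)^a and beta^(a l2), hence
   (a, b): this is what the choice between ord(alpha beta) and its double in l1 achieves.
   A vector of minimal support in a nonzero submodule is therefore a multiple of a basis vector,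
   and X11 and X21 permute the basis vectors transitively up to nonzero scalars. *)
theory Submission
  imports Defs
begin

section \<open>Orders of elements and walks around a cycle\<close>

lemma power_eq_iff_ord_dvd:
  fixes x :: "'k::field"
  assumes "x \<noteq> 0" "m \<le> n"
  shows "x ^ m = x ^ n \<longleftrightarrow> ord x dvd n - m"
proof -
  have "x ^ n = x ^ m * x ^ (n - m)"
    using assms by (simp flip: power_add)
  then show ?thesis
    using assms by (simp flip: ord_iff)
qed

lemma cyclic_induct:
  fixes l :: nat
  assumes "x < l" "P x" "\<And>a. a < l \<Longrightarrow> P a \<Longrightarrow> P (Suc a mod l)" "y < l"
  shows "P y"
proof -
  have "P ((x + n) mod l)" for n
  proof (induction n)
    case (Suc n)
    then have "P (Suc ((x + n) mod l) mod l)"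
      using assms by (intro assms(3)) auto
    then show ?case by (simp add: mod_Suc_eq)
  qed (use assms in simp)
  \<comment> \<open>Walking \<open>l - x\<close> steps from \<open>x\<close> reaches 0 modulo
    \<open>l\<close>, and \<open>y\<close> further steps reach \<open>y\<close>; this also covers
    \<open>y < x\<close>.\<close>
  from this[of "l - x + y"] assms show ?thesis by simp
qed

context V1_setup
begin

text \<open>The base \<open>inverse \<alpha> * \<beta>\<close> has order \<open>L2\<close>, so its
  power fixes \<open>b\<close>. The power of \<open>\<alpha> * \<beta>\<close> fixes
  \<open>a\<close> modulo its order. If \<open>L1\<close> is twice that order, one ambiguity
  remains, and the power of \<open>\<beta>\<close> resolves it.\<close>

lemma indices_separated:
  assumes "(a, b) \<in> indices" "(a', b') \<in> indices"
    and "(inverse \<alpha> * \<beta>) ^ b = (inverse \<alpha> * \<beta>) ^ b'"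
    and "(\<alpha> * \<beta>) ^ a = (\<alpha> * \<beta>) ^ a'"
    and "\<beta> ^ (a * L2) = \<beta> ^ (a' * L2)"
  shows "(a, b) = (a', b')"
proof -
  \<comment> \<open>\<open>L2\<close> is defined as the order of
    \<open>\<alpha> * inverse \<beta>\<close>, whereas the eigenvalues involve powers of its
    inverse.\<close>
  have q: "(\<alpha> * inverse \<beta>) ^ n = inverse ((inverse \<alpha> * \<beta>) ^ n)" for n
    by (simp flip: power_inverse)
  have b: "b = b'"
    if "b \<le> b'" "b' < L2" "(inverse \<alpha> * \<beta>) ^ b = (inverse \<alpha> * \<beta>) ^ b'" for b b'
  proof -
    have "L2 dvd b' - b"
      using that power_eq_iff_ord_dvd[OF nzi(2) that(1)] q by (simp add: l2_def)
    with that show ?thesis by (auto dest: dvd_imp_le)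
  qed
  have a: "a = a'"
    if le: "a \<le> a'" and lt: "a' < L1" and ab: "(\<alpha> * \<beta>) ^ a = (\<alpha> * \<beta>) ^ a'"
      and bL: "\<beta> ^ (a * L2) = \<beta> ^ (a' * L2)" for a a'
  proof (rule ccontr)
    assume "a \<noteq> a'"
    then have pos: "a' - a > 0" using le by simp
    from le ab have d: "ord (\<alpha> * \<beta>) dvd a' - a"
      using power_eq_iff_ord_dvd[OF nzi(1)] by blast
    then obtain k where k: "a' - a = ord (\<alpha> * \<beta>) * k" by blast
    \<comment> \<open>A positive multiple of \<open>ord (\<alpha> * \<beta>)\<close> below
      \<open>L1\<close> exists only in the doubled case of \<open>l1\<close>, and there it must be
      the order itself.\<close>
    have "\<not> ord (\<alpha> * \<beta>) > a' - a" using d pos by (auto dest: dvd_imp_le)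
    then have n: "\<not> ord \<beta> dvd ord (\<alpha> * \<beta>) * L2" and L: "L1 = 2 * ord (\<alpha> * \<beta>)"
      using lt by (auto simp: l1_def l2_def split: if_splits)
    have "ord (\<alpha> * \<beta>) * k < ord (\<alpha> * \<beta>) * 2" using lt L k by linarith
    then have "k = 1" using k pos by (cases k) auto
    moreover have "ord \<beta> dvd a' * L2 - a * L2"
      using power_eq_iff_ord_dvd[OF nz(2), of "a * L2" "a' * L2"] le bL by auto
    \<comment> \<open>With \<open>k = 1\<close> the divisibility reads
      \<open>ord \<beta> dvd ord (\<alpha> * \<beta>) * L2\<close>, the very condition whose failure
      caused the doubling.\<close>
    ultimately show False using n k by (simp flip: diff_mult_distrib)
  qed
  have lt: "a < L1" "a' < L1" "b < L2" "b' < L2" using assms(1,2) by (auto simp: indices_def)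
  have "a = a'" using a[of a a'] a[of a' a] lt assms(4,5) by (metis nle_le)
  moreover have "b = b'" using b[of b b'] b[of b' b] lt assms(3) by (metis nle_le)
  ultimately show ?thesis by simp
qed

section \<open>Diagonal elements and their joint eigenvalues\<close>

definition diagonal :: "(word \<Rightarrow>\<^sub>0 'k) \<Rightarrow> (nat \<times> nat \<Rightarrow> 'k) \<Rightarrow> bool"
  where "diagonal p d \<longleftrightarrow> (\<forall>a b. (a, b) \<in> indices \<longrightarrow> act p (e a b) = scale (d (a, b)) (e a b))"

lemma single_eq_scale_e: "Poly_Mapping.single x c = scale c (e (fst x) (snd x))"
  by (auto intro!: poly_mapping_eqI simp: e_def lookup_scale lookup_single when_def)

lemma act_sum: "act p (sum f A) = (\<Sum>x\<in>A. act p (f x))"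
  by (induction A rule: infinite_finite_induct) (auto simp: act_addv)

text \<open>Expanding \<open>v\<close> in basis vectors, each term is scaled by its own eigenvalue.
  No condition on \<open>x\<close> is required: outside the support of \<open>v\<close> both sides
  vanish.\<close>

lemma lookup_act_diagonal:
  assumes "diagonal p d" "v \<in> carrier V"
  shows "Poly_Mapping.lookup (act p v) x = d x * Poly_Mapping.lookup v x"
proof -
  have "act p v = (\<Sum>y\<in>Poly_Mapping.keys v. act p (Poly_Mapping.single y (Poly_Mapping.lookup v y)))"
    using arg_cong[OF pm_decomp, of "act p" v] by (simp only: act_sum)
  also have "\<dots> = (\<Sum>y\<in>Poly_Mapping.keys v. Poly_Mapping.single y (d y * Poly_Mapping.lookup v y))"
  proof (rule sum.cong[OF refl])
    fix y assume "y \<in> Poly_Mapping.keys v"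
    then have "y \<in> indices" using assms by (auto simp: carrier_V)
    then show "act p (Poly_Mapping.single y (Poly_Mapping.lookup v y))
        = Poly_Mapping.single y (d y * Poly_Mapping.lookup v y)"
      using assms(1) by (cases y) (simp add: single_eq_scale_e act_scalev diagonal_def mult.commute)
  qed
  finally show ?thesis
    by (auto simp: lookup_sum lookup_single when_def in_keys_iff)
qed

lemma diagonal_X12_X21:
  "diagonal (var X12 * var X21) (\<lambda>(a, b). \<mu>3 * (inverse \<alpha> * \<beta>) ^ b * inverse ((\<alpha> * \<beta>) ^ a))"
  by (auto simp: diagonal_def indices_def act_mult act_var X12_X21)

lemma diagonal_X22_X11:
  "diagonal (var X22 * var X11)
    (\<lambda>(a, b). (inverse \<alpha> * \<beta>) ^ b * (\<mu>4 + \<beta> * inverse ((\<alpha> * \<beta>) ^ a) * \<mu>3))"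
  by (auto simp: diagonal_def indices_def act_mult act_var X22_X11)

text \<open>The bound keeps the walk in \<open>b\<close> from wrapping around, so only factors
  \<open>\<mu>2\<close> accumulate.\<close>

lemma act_X21_power:
  "b + n < L2 \<Longrightarrow> act (var X21 ^ n) (e a b) = scale (\<mu>2 ^ n) (e a (b + n))"
proof (induction n)
  case 0
  then show ?case using act_const[of 1] by (simp add: const_def)
next
  case (Suc n)
  then have "b + n \<noteq> L2 - 1" by linarith
  \<comment> \<open>The new factor is split off on the right, where it acts last, after the
    \<open>n\<close> factors of the induction hypothesis.\<close>
  with Suc show ?case
    by (simp add: power_Suc2 act_mult act_var G_e lin_ext_scale mult.commute del: power_Suc)
qed

text \<open>A full turn in \<open>b\<close> crosses the boundary from \<open>L2 - 1\<close> to 0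
  exactly once, whatever the starting point, and collects the twist there.\<close>

lemma diagonal_X21_power: "diagonal (var X21 ^ L2) (\<lambda>(a, b). \<mu>2 ^ L2 * inverse (\<beta> ^ (a * L2)))"
  unfolding diagonal_def
proof (intro allI impI)
  fix a b assume "(a, b) \<in> indices"
  then have b: "b < L2" by (simp add: indices_def)
  define m where "m = L2 - 1 - b"
  have L: "L2 = m + 1 + b" and m: "b + m = L2 - 1" using b by (simp_all add: m_def)
  \<comment> \<open>The turn is cut into \<open>m\<close> steps up to \<open>L2 - 1\<close>, one
    wrapping step to 0, and \<open>b\<close> steps back to the start.\<close>
  have "var X21 ^ L2 = var X21 ^ m * (var X21 * var X21 ^ b :: word \<Rightarrow>\<^sub>0 'k)"
    by (subst L) (simp only: power_add power_one_right mult.assoc)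
  then have "act (var X21 ^ L2) (e a b) = act (var X21 ^ b) (G X21 (act (var X21 ^ m) (e a b)))"
    by (simp add: act_mult act_var)
  also have "act (var X21 ^ m) (e a b) = scale (\<mu>2 ^ m) (e a (L2 - 1))"
    using act_X21_power[of b m a] b m by simp
  also have "G X21 \<dots> = scale (\<mu>2 ^ m * \<mu>2 * inverse (\<beta> ^ (a * L2))) (e a 0)"
    by (simp add: G_e lin_ext_scale pown mult.assoc del: of_nat_mult)
  also have "act (var X21 ^ b) \<dots> = scale (\<mu>2 ^ (m + 1 + b) * inverse (\<beta> ^ (a * L2))) (e a b)"
    using act_X21_power[of 0 b a] b by (simp add: act_scalev power_add mult_ac)
  finally show "act (var X21 ^ L2) (e a b)
      = scale (case (a, b) of (a, b) \<Rightarrow> \<mu>2 ^ L2 * inverse (\<beta> ^ (a * L2))) (e a b)"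
    by (simp only: prod.case flip: L)
qed

text \<open>If the three diagonal elements above all had equal eigenvalues at \<open>x\<close> and
  \<open>y\<close>, solving for the powers would contradict
  \<open>indices_separated\<close>.\<close>

lemma ex_separating_diagonal:
  assumes "\<mu>3 \<noteq> 0" "\<mu>4 \<noteq> 0" "x \<in> indices" "y \<in> indices" "x \<noteq> y"
  shows "\<exists>p d. diagonal p d \<and> d x \<noteq> d y"
proof (rule ccontr)
  assume "\<not> ?thesis"
  then have eq: "d x = d y" if "diagonal p d" for p d using that by blast
  obtain a b a' b' where xy: "x = (a, b)" "y = (a', b')" by (cases x; cases y)
  define q where "q = inverse \<alpha> * \<beta>"
  define t where "t a = inverse ((\<alpha> * \<beta>) ^ a)" for a :: nat
  have 1: "\<mu>3 * q ^ b * t a = \<mu>3 * q ^ b' * t a'"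
    using eq[OF diagonal_X12_X21] by (simp add: xy q_def t_def)
  have 2: "q ^ b * (\<mu>4 + \<beta> * t a * \<mu>3) = q ^ b' * (\<mu>4 + \<beta> * t a' * \<mu>3)"
    using eq[OF diagonal_X22_X11] by (simp add: xy q_def t_def)
  have 3: "\<beta> ^ (a * L2) = \<beta> ^ (a' * L2)"
    using eq[OF diagonal_X21_power] nz by (simp add: xy)
  \<comment> \<open>Subtracting \<open>\<beta>\<close> times the first eigenvalue from the second
    cancels \<open>t a\<close>. Dividing by \<open>\<mu>4\<close> isolates \<open>q ^ b\<close>, and
    the first eigenvalue then yields \<open>t a\<close>.\<close>
  have "q ^ b * \<mu>4 = q ^ b * (\<mu>4 + \<beta> * t a * \<mu>3) - \<beta> * (\<mu>3 * q ^ b * t a)"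
    by (simp add: algebra_simps)
  also have "\<dots> = q ^ b' * \<mu>4"
    unfolding 1 2 by (simp add: algebra_simps)
  finally have q: "q ^ b = q ^ b'" using assms by simp
  moreover have "q \<noteq> 0" using nz by (simp add: q_def)
  ultimately have "t a = t a'" using 1 assms by simp
  then have "(\<alpha> * \<beta>) ^ a = (\<alpha> * \<beta>) ^ a'" by (simp add: t_def)
  with q 3 show False
    using indices_separated[of a b a' b'] assms xy by (simp add: q_def)
qed

section \<open>Submodules: from a nonzero vector to the whole space\<close>

context
  fixes N
  assumes N: "submodule N (M2 \<alpha> \<beta>) V"
begin

lemma N_carrier: "v \<in> N \<Longrightarrow> v \<in> carrier V"
  using subgroup.subset[OF submodule.axioms(1)[OF N]] by auto

lemma N_zero: "0 \<in> N"
  using subgroup.one_closed[OF submodule.axioms(1)[OF N]] by (simp add: V1_def)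

lemma N_add: "u \<in> N \<Longrightarrow> v \<in> N \<Longrightarrow> u + v \<in> N"
  using subgroup.m_closed[OF submodule.axioms(1)[OF N]] by (simp add: V1_def)

lemma N_sum: "(\<And>x. x \<in> A \<Longrightarrow> f x \<in> N) \<Longrightarrow> sum f A \<in> N"
  by (induction A rule: infinite_finite_induct) (auto simp: N_zero N_add)

lemma N_act:
  assumes "v \<in> N" shows "act p v \<in> N"
proof -
  have "qm_ideal \<alpha> \<beta> +>\<^bsub>free_algebra\<^esub> p \<in> carrier (M2 \<alpha> \<beta>)"
    by (auto simp: M2_def FactRing_def A_RCOSETS_def RCOSETS_def a_r_coset_def)
  from submodule.smult_closed[OF N this assms] show ?thesis
    by (simp add: V1_smult N_carrier assms)
qed

lemma N_scale: "v \<in> N \<Longrightarrow> scale c v \<in> N"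
  using N_act[of v "const c"] by (simp add: act_const)

lemma N_unscale: "scale c v \<in> N \<Longrightarrow> c \<noteq> 0 \<Longrightarrow> v \<in> N"
  using N_scale[of "scale c v" "inverse c"] by simp

text \<open>\<open>X11\<close> advances \<open>a\<close> and \<open>X21\<close> advances
  \<open>b\<close> cyclically with nonzero coefficients, so forward steps reach every index. The
  coefficient of \<open>X22\<close>, by contrast, can vanish.\<close>

lemma N_all_e:
  assumes "e a b \<in> N" "(a, b) \<in> indices" "(a', b') \<in> indices"
  shows "e a' b' \<in> N"
proof -
  have lt: "a < L1" "a' < L1" "b < L2" "b' < L2" using assms by (auto simp: indices_def)
  have "e a' b \<in> N"
  proof (rule cyclic_induct[of a L1 "\<lambda>a. e a b \<in> N"])
    fix a assume a: "a < L1" "e a b \<in> N"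
    have "plus_mod L1 a 1 = Suc a mod L1"
      using a by (auto simp: pm1 mod_Suc)
    then have "scale (\<mu>1 * \<beta> ^ b) (e (Suc a mod L1) b) \<in> N"
      using N_act[OF a(2), of "var X11"] by (simp add: act_var G_e)
    then show "e (Suc a mod L1) b \<in> N" by (rule N_unscale) (use nz in simp)
  qed (use lt assms in auto)
  then show ?thesis
  proof (rule cyclic_induct[of b L2 "\<lambda>b. e a' b \<in> N", rotated])
    fix b assume b: "b < L2" "e a' b \<in> N"
    define c where "c = (if b \<noteq> L2 - 1 then \<mu>2 else \<mu>2 * inverse (\<beta> ^ (a' * L2)))"
    have "G X21 (e a' b) = scale c (e a' (Suc b mod L2))"
      using b by (auto simp: G_e c_def pown mod_Suc simp del: of_nat_mult)
    then have "scale c (e a' (Suc b mod L2)) \<in> N"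
      using N_act[OF b(2), of "var X21"] by (simp add: act_var)
    then show "e a' (Suc b mod L2) \<in> N" by (rule N_unscale) (use nz in \<open>simp add: c_def\<close>)
  qed (use lt in auto)
qed

lemma N_contains_e:
  assumes "\<mu>3 \<noteq> 0" "\<mu>4 \<noteq> 0" "N \<noteq> {0}"
  shows "\<exists>a b. (a, b) \<in> indices \<and> e a b \<in> N"
proof -
  have "\<exists>v. v \<in> N \<and> v \<noteq> 0" using N_zero assms by auto
  then obtain v where v: "v \<in> N" "v \<noteq> 0"
    and min: "\<And>u. u \<in> N \<Longrightarrow> u \<noteq> 0 \<Longrightarrow> card (Poly_Mapping.keys v) \<le> card (Poly_Mapping.keys u)"
    using ex_has_least_nat[of "\<lambda>v. v \<in> N \<and> v \<noteq> 0" _ "\<lambda>v. card (Poly_Mapping.keys v)"] by blast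
  obtain x where x: "x \<in> Poly_Mapping.keys v" using v by (metis keys_eq_empty all_not_in_conv)
  have ind: "Poly_Mapping.keys v \<subseteq> indices" using N_carrier[OF v(1)] by (simp add: carrier_V)
  have only: "y = x" if y: "y \<in> Poly_Mapping.keys v" for y
  proof (rule ccontr)
    assume "y \<noteq> x"
    then obtain p d where p: "diagonal p d" "d x \<noteq> d y"
      using ex_separating_diagonal[of x y] x y ind assms by blast
    \<comment> \<open>The coefficient at \<open>x\<close> is cancelled, the one at \<open>y\<close>
      survives because the eigenvalues differ, and no new index enters: \<open>u\<close> is nonzero
      in \<open>N\<close> with smaller support than \<open>v\<close>.\<close>
    define u where "u = act p v + scale (- d x) v"
    have u: "Poly_Mapping.lookup u z = (d z - d x) * Poly_Mapping.lookup v z" for z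
      using lookup_act_diagonal[OF p(1) N_carrier[OF v(1)]]
      by (simp add: u_def lookup_add lookup_scale left_diff_distrib)
    have "Poly_Mapping.keys u \<subset> Poly_Mapping.keys v"
      using x by (auto simp: in_keys_iff u)
    then have "card (Poly_Mapping.keys u) < card (Poly_Mapping.keys v)"
      by (simp add: psubset_card_mono)
    moreover have "y \<in> Poly_Mapping.keys u" using y p by (simp add: in_keys_iff u)
    then have "u \<noteq> 0" by auto
    moreover have "u \<in> N" unfolding u_def by (intro N_add N_act N_scale v)
    ultimately show False using min[of u] by simp
  qed
  obtain a b where ab: "x = (a, b)" by (cases x)
  have "Poly_Mapping.keys v = {x}" using x only by blast
  then have "Poly_Mapping.lookup v y = 0" if "y \<noteq> x" for y
    using that by (metis in_keys_iff singletonD)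
  then have "Poly_Mapping.single x (Poly_Mapping.lookup v x) = v"
    by (intro poly_mapping_eqI) (simp add: lookup_single when_def)
  then have "scale (Poly_Mapping.lookup v x) (e a b) = v"
    unfolding single_eq_scale_e ab fst_conv snd_conv .
  then have "scale (Poly_Mapping.lookup v x) (e a b) \<in> N"
    using v(1) by (rule ssubst)
  then have "e a b \<in> N" by (rule N_unscale) (use x in \<open>simp add: in_keys_iff\<close>)
  then show ?thesis using x ind ab by blast
qed

lemma N_trivial:
  assumes "\<mu>3 \<noteq> 0" "\<mu>4 \<noteq> 0" "N \<noteq> {0}"
  shows "N = carrier V"
proof
  show "carrier V \<subseteq> N"
  proof
    fix v assume "v \<in> carrier V"
    then have "Poly_Mapping.single x (Poly_Mapping.lookup v x) \<in> N" if "x \<in> Poly_Mapping.keys v" for x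
      using that N_contains_e[OF assms] N_all_e[of _ _ "fst x" "snd x"]
      by (cases x) (auto simp: single_eq_scale_e carrier_V intro!: N_scale)
    then have "(\<Sum>x\<in>Poly_Mapping.keys v. Poly_Mapping.single x (Poly_Mapping.lookup v x)) \<in> N"
      by (rule N_sum)
    then show "v \<in> N" by (simp only: flip: pm_decomp)
  qed
qed (use N_carrier in blast)

end

section \<open>Simplicity and dimension\<close>

lemma simple_V1:
  assumes "\<mu>3 \<noteq> 0" "\<mu>4 \<noteq> 0"
  shows "simple_right_module (M2 \<alpha> \<beta>) V"
proof -
  have "e 0 0 \<in> carrier V" using L1_pos L2_pos by (rule V_e)
  moreover have "e 0 0 \<noteq> (0 :: nat \<times> nat \<Rightarrow>\<^sub>0 'k)"
    using arg_cong[of "e 0 0" 0 "\<lambda>v. Poly_Mapping.lookup v (0, 0)"] by (auto simp: e_def)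
  moreover have "\<zero>\<^bsub>V\<^esub> = 0" by (simp add: V1_def)
  ultimately show ?thesis
    using right_module_V1 N_trivial assms
    by (intro simple_right_module.intro simple_right_module_axioms.intro) auto
qed

lemma dim_V1: "vector_space.dim scale (carrier V) = L1 * L2"
proof -
  interpret vector_space "scale :: 'k \<Rightarrow> (nat \<times> nat \<Rightarrow>\<^sub>0 'k) \<Rightarrow> _" by (rule vector_space_scale)
  let ?s = "\<lambda>x. Poly_Mapping.single x (1 :: 'k)"
  \<comment> \<open>Independence and cardinality concern the set of basis vectors; injectivity
    transfers both to the index set.\<close>
  have inj: "inj_on ?s A" for A
    by (rule inj_onI) (metis lookup_single_eq lookup_single_not_eq zero_neq_one)
  have s: "scale c (?s x) = Poly_Mapping.single x c" for c x
    by (auto intro!: poly_mapping_eqI simp: lookup_scale lookup_single when_def)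
  show ?thesis
  proof (rule dim_unique[of "?s ` indices"])
    show "?s ` indices \<subseteq> carrier V" by (auto simp: carrier_V)
    show "carrier V \<subseteq> span (?s ` indices)"
    proof
      fix v assume "v \<in> carrier V"
      then have "(\<Sum>x\<in>Poly_Mapping.keys v. scale (Poly_Mapping.lookup v x) (?s x)) \<in> span (?s ` indices)"
        by (intro span_sum span_scale span_base) (auto simp: carrier_V)
      then show "v \<in> span (?s ` indices)"
        by (simp only: s flip: pm_decomp)
    qed
    show "independent (?s ` indices)"
    proof (rule independent_if_scalars_zero)
      show "finite (?s ` indices)" by (simp add: indices_def)
      fix f v assume 0: "(\<Sum>v\<in>?s ` indices. scale (f v) v) = 0" and "v \<in> ?s ` indices"
      then obtain x where x: "x \<in> indices" "v = ?s x" by blast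
      \<comment> \<open>Reading off the coordinate at \<open>x\<close> leaves only the scalar
        attached to \<open>v\<close>.\<close>
      have "0 = Poly_Mapping.lookup (\<Sum>y\<in>indices. scale (f (?s y)) (?s y)) x"
        using 0 by (simp add: sum.reindex[OF inj])
      also have "\<dots> = f v"
        using x by (simp add: s lookup_sum lookup_single when_def indices_def)
      finally show "f v = 0" by simp
    qed
    show "card (?s ` indices) = L1 * L2"
      by (simp add: card_image[OF inj] indices_def card_cartesian_product)
  qed
qed

end

theorem theorem5p1:
  fixes \<alpha> \<beta> \<mu>1 \<mu>2 \<mu>3 \<mu>4 :: "'k::alg_closed_field"
  assumes "\<alpha> \<noteq> 0" and "\<beta> \<noteq> 0" and "root_of_unity \<alpha>" and "root_of_unity \<beta>"
    and "\<alpha> * \<beta> \<noteq> 1"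
    and "\<mu>1 \<noteq> 0" and "\<mu>2 \<noteq> 0" and "\<mu>3 \<noteq> 0" and "\<mu>4 \<noteq> 0"
  shows "simple_right_module (M2 \<alpha> \<beta>) (V1 \<alpha> \<beta> \<mu>1 \<mu>2 \<mu>3 \<mu>4) \<and>
    vector_space.dim scale (carrier (V1 \<alpha> \<beta> \<mu>1 \<mu>2 \<mu>3 \<mu>4)) = l1 \<alpha> \<beta> * l2 \<alpha> \<beta>"
proof -
  interpret V1_setup \<alpha> \<beta> \<mu>1 \<mu>2 \<mu>3 \<mu>4 using assms by unfold_locales
  show ?thesis using simple_V1 dim_V1 assms by blast
qed

end
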